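(* For all $\alpha>0$, $k^t\in\mathbb{N}$, $k^d\in\mathbb{N}$, the best-case drone-impact ratio of the policy Optimistic satisfies $$\underline{\omega}(\mathrm{Optimistic})\ \le\ \frac{1}{1+\alpha\frac{k^d}{k^t}}.$$
   Context: Relief distribution problem (RDP). $\mathbb{N}=\{1,2,\dots\}$. An instance is $I=(k^t,k^d,\alpha,G,D)$: $k^t,k^d\in\mathbb{N}$ are the numbers of trucks and drones; $\alpha>0$ is the drone speed; $G=(V,E,c)$ is a finite connected undirected graph (not necessarily complete) with $V=\{v_0\}\cup C$, where $v_0$ is the depot and $C\neq\emptyset$ is the set of non-depot nodes; edge lengths $c(i,j)>0$ satisfy the triangle inequality; $D\subseteq C$ is the set of damaged nodes, initially unknown; the status of a node is revealed when some vehicle first arrives at it. For non-adjacent $i,j$, $c(i,j)$ is the shortest-path distance. A truck needs time $c(i,j)$ to traverse an edge, a drone needs $\frac1\alpha c(i,j)$. A tour is a closed walk in $G$ starting and ending at $v_0$ (possibly of length $0$); it visits all nodes lying on it. The makespan of a family of tours is the maximum duration of a tour. For integers $m,n\ge 0$ with $m+n\ge1$ and $W\subseteq C$, $\mathrm{TSP}_{m,n}(W)$ denotes the minimum makespan over all families of $m$ truck tours and $n$ drone tours that together visit all nodes of $W$, and $S^*_{m,n}(W)$ denotes an optimal such family. Policy Optimistic (deterministic; optimal families are selected by a fixed rule based only on the information available at that time, so the first-stage tours do not depend on $D$). First stage: the vehicles execute the tours of $S^*_{k^t,k^d}(C)$ and return to the depot. Let $D^d\subseteq D$ be the set of damaged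 nodes not visited by truck tours in this stage. Second stage (after all vehicles returned): the trucks execute $S^*_{k^t,0}(D^d)$. Its makespan is $\mathrm{Optimistic}(I)=\mathrm{TSP}_{k^t,k^d}(C)+\mathrm{TSP}_{k^t,0}(D^d)$. Best-case drone-impact ratio: $\underline{\omega}(\mathrm{Optimistic})=\inf_I \frac{\mathrm{Optimistic}(I)}{\mathrm{TSP}_{k^t,0}(C)}$, the infimum being over all instances $I$ with the given $k^t,k^d,\alpha$ (and $C=C(I)$). *)

theory Defs
  imports "Graph_Theory.Graph_Theory"
begin

type_synonym 'v tour = "('v \<times> 'v) list"

text \<open>The list of truck tours and the list of drone tours.\<close>
type_synonym 'v family = "'v tour list \<times> 'v tour list"

text \<open>The length \<open>c(i,j)\<close> on all pairs of nodes: shortest-path distance off the edges.\<close>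
definition node_dist :: "'v pair_pre_digraph \<Rightarrow> ('v \<times> 'v \<Rightarrow> real) \<Rightarrow> 'v \<Rightarrow> 'v \<Rightarrow> real" where
  "node_dist G c i j =
    (if (i, j) \<in> parcs G then c (i, j)
     else real_of_ereal (wf_digraph.\<mu> (with_proj G) c i j))"

text \<open>
  An undirected graph is a symmetric digraph: the arcs \<open>(i, j)\<close> and \<open>(j, i)\<close> are the two
  directions of one edge, hence \<open>len_sym\<close>. The name \<open>connected\<close> is qualified because it also
  denotes topological connectedness.
\<close>
locale relief_network = pair_graph G
  for G :: "'v pair_pre_digraph" +
  fixes c :: "'v \<times> 'v \<Rightarrow> real" and depot :: 'v
  assumes connected: "Digraph_Component.connected (with_proj G)"
    and depot_in_verts: "depot \<in> pverts G"
    and customers_nonempty: "pverts G - {depot} \<noteq> {}"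
    and len_pos: "e \<in> parcs G \<Longrightarrow> c e > 0"
    and len_sym: "(i, j) \<in> parcs G \<Longrightarrow> c (i, j) = c (j, i)"
    and triangle:
      "\<lbrakk>i \<in> pverts G; j \<in> pverts G; k \<in> pverts G\<rbrakk> \<Longrightarrow>
        node_dist G c i k \<le> node_dist G c i j + node_dist G c j k"
begin

definition customers :: "'v set" where
  "customers = pverts G - {depot}"

definition is_tour :: "'v tour \<Rightarrow> bool" where
  "is_tour p \<longleftrightarrow> awalk depot p depot"

definition visited :: "'v tour list \<Rightarrow> 'v set" where
  "visited ps = (\<Union>p\<in>set ps. set (awalk_verts depot p))"

definition families :: "nat \<Rightarrow> nat \<Rightarrow> 'v set \<Rightarrow> 'v family set" where
  "families m n W =
    {(T, R). length T = m \<and> length R = n \<and> (\<forall>p\<in>set T \<union> set R. is_tour p)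
             \<and> W \<subseteq> visited T \<union> visited R}"

text \<open>The maximum ranges over a nonempty set as soon as there is at least one vehicle.\<close>
definition makespan :: "real \<Rightarrow> 'v family \<Rightarrow> real" where
  "makespan \<alpha> F =
    Max (awalk_cost c ` set (fst F) \<union> awalk_cost (\<lambda>e. 1 / \<alpha> * c e) ` set (snd F))"

definition optimal_family :: "real \<Rightarrow> nat \<Rightarrow> nat \<Rightarrow> 'v set \<Rightarrow> 'v family \<Rightarrow> bool" where
  "optimal_family \<alpha> m n W F \<longleftrightarrow> is_arg_min (makespan \<alpha>) (\<lambda>F. F \<in> families m n W) F"

text \<open>The least element exists by \<open>ex_optimal_family\<close> and \<open>TSP_eqI\<close> below.\<close>
definition TSP :: "real \<Rightarrow> nat \<Rightarrow> nat \<Rightarrow> 'v set \<Rightarrow> real" where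
  "TSP \<alpha> m n W = (LEAST t. t \<in> makespan \<alpha> ` families m n W)"

text \<open>\<open>F\<close> is the family executed in the first stage and \<open>D\<close> is the set of damaged nodes.\<close>
definition optimistic :: "nat \<Rightarrow> nat \<Rightarrow> real \<Rightarrow> 'v family \<Rightarrow> 'v set \<Rightarrow> real" where
  "optimistic kt kd \<alpha> F D = TSP \<alpha> kt kd customers + TSP \<alpha> kt 0 (D - visited (fst F))"

lemma TSP_eqI:
  assumes "optimal_family \<alpha> m n W F"
  shows "TSP \<alpha> m n W = makespan \<alpha> F"
  using assms unfolding TSP_def optimal_family_def is_arg_min_linorder
  by (intro Least_equality) auto

lemma ex_tour_through:
  assumes "v \<in> pverts G"
  shows "\<exists>p. is_tour p \<and> v \<in> set (awalk_verts depot p)"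
proof -
  have sym: "symmetric (with_proj G)" by (rule sym_arcs)
  have reach: "x \<rightarrow>\<^sup>*\<^bsub>with_proj G\<^esub> y" if "x \<in> pverts G" "y \<in> pverts G" for x y
  proof -
    have "x \<rightarrow>\<^sup>*\<^bsub>with_proj (mk_symmetric (with_proj G))\<^esub> y"
      using connected that by (auto simp: connected_def strongly_connected_def)
    then show ?thesis using reachable_mk_symmetric_eq[OF sym] by blast
  qed
  obtain p q where p: "awalk depot p v" and q: "awalk v q depot"
    using reach assms depot_in_verts by (meson reachable_awalk)
  have pq: "awalk depot (p @ q) depot" using p q by (rule awalk_appendI)
  have "v \<in> set (awalk_verts depot (p @ q))"
    using p q pq by (metis UnCI awalk_verts_non_Nil awalkE hd_in_set set_awalk_verts_append)
  with pq show ?thesis unfolding is_tour_def by blast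
qed

lemma ex_tour_covering:
  assumes "finite W" "W \<subseteq> pverts G"
  shows "\<exists>p. is_tour p \<and> W \<subseteq> set (awalk_verts depot p)"
  using assms
proof (induction W rule: finite_induct)
  case empty
  have "is_tour []" using depot_in_verts by (simp add: is_tour_def awalk_Nil_iff)
  then show ?case by blast
next
  case (insert v W)
  obtain p where p: "is_tour p" "W \<subseteq> set (awalk_verts depot p)" using insert by auto
  obtain q where q: "is_tour q" "v \<in> set (awalk_verts depot q)"
    using ex_tour_through[of v] insert.prems by blast
  have pq: "is_tour (p @ q)" using p(1) q(1) unfolding is_tour_def by (rule awalk_appendI)
  have "set (awalk_verts depot (p @ q)) = set (awalk_verts depot p) \<union> set (awalk_verts depot q)"
    using p(1) q(1) pq unfolding is_tour_def by (metis set_awalk_verts_append awalk_append_iff awalk_ends_eqD)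
  with pq p q show ?case by blast
qed

lemma families_nonempty:
  assumes "m + n \<ge> 1" "W \<subseteq> pverts G"
  shows "families m n W \<noteq> {}"
proof -
  obtain p where p: "is_tour p" "W \<subseteq> set (awalk_verts depot p)"
    using ex_tour_covering assms(2) pair_finite_verts finite_subset by metis
  have "(replicate m p, replicate n p) \<in> families m n W"
    using p assms(1) by (auto simp: families_def visited_def)
  then show ?thesis by blast
qed

lemma ex_optimal_family:
  assumes "\<alpha> > 0" "m + n \<ge> 1" "W \<subseteq> pverts G"
  shows "\<exists>F. optimal_family \<alpha> m n W F"
proof -
  define \<delta> where "\<delta> = Min (insert 1 (c ` parcs G))"
  have \<delta>0: "\<delta> > 0" unfolding \<delta>_def using len_pos pair_finite_arcs by auto
  have \<delta>c: "\<delta> \<le> c e" if "e \<in> parcs G" for e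
    unfolding \<delta>_def using that pair_finite_arcs by auto
  have len: "real (length p) * \<delta> \<le> awalk_cost c p" if "set p \<subseteq> parcs G" for p
    using that by (induction p) (auto simp: algebra_simps dest!: \<delta>c)
  have drone: "awalk_cost (\<lambda>e. 1 / \<alpha> * c e) p = awalk_cost c p / \<alpha>" for p
    by (induction p) (auto simp: add_divide_distrib)
  obtain F0 where F0: "F0 \<in> families m n W" using families_nonempty assms by blast
  define B where "B = makespan \<alpha> F0"
  define L where "L = nat \<lceil>max B (\<alpha> * B) / \<delta>\<rceil>"
  define P where "P = {p :: 'v tour. set p \<subseteq> parcs G \<and> length p \<le> L}"
  define A where "A = {F \<in> families m n W. makespan \<alpha> F \<le> B}"
  have short: "p \<in> P" if "set p \<subseteq> parcs G" "awalk_cost c p \<le> max B (\<alpha> * B)" for p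
  proof -
    have "real (length p) \<le> max B (\<alpha> * B) / \<delta>"
      using len[OF that(1)] that(2) \<delta>0 by (simp add: pos_le_divide_eq)
    then have "length p \<le> L" unfolding L_def by linarith
    then show ?thesis using that by (simp add: P_def)
  qed
  have "A \<subseteq> {T. set T \<subseteq> P \<and> length T = m} \<times> {R. set R \<subseteq> P \<and> length R = n}"
  proof (clarify)
    fix T R assume "(T, R) \<in> A"
    then have fam: "(T, R) \<in> families m n W" and mk: "makespan \<alpha> (T, R) \<le> B"
      by (auto simp: A_def)
    have arcs: "set p \<subseteq> parcs G" if "p \<in> set T \<union> set R" for p
      using fam that by (auto simp: families_def is_tour_def awalk_def)
    have le: "x \<le> B" if "x \<in> awalk_cost c ` set T \<union> awalk_cost (\<lambda>e. 1 / \<alpha> * c e) ` set R" for x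
      using mk that unfolding makespan_def fst_conv snd_conv
      by (meson List.finite_set Max_ge finite_UnI finite_imageI order_trans)
    have "p \<in> P" if "p \<in> set T" for p
      using le[of "awalk_cost c p"] arcs[of p] that by (intro short) auto
    moreover have "p \<in> P" if "p \<in> set R" for p
    proof -
      have "awalk_cost c p / \<alpha> \<le> B" using le[of "awalk_cost c p / \<alpha>"] that drone by force
      then have "awalk_cost c p \<le> \<alpha> * B" using assms(1) by (simp add: field_simps)
      then show ?thesis using arcs[of p] that by (intro short) auto
    qed
    moreover have "length T = m" "length R = n" using fam by (auto simp: families_def)
    ultimately show "T \<in> {T. set T \<subseteq> P \<and> length T = m} \<and> R \<in> {R. set R \<subseteq> P \<and> length R = n}" by blast
  qed
  moreover have "finite P" unfolding P_def using pair_finite_arcs by (rule finite_lists_length_le)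
  ultimately have fin: "finite A"
    by (elim finite_subset) (intro finite_cartesian_product finite_lists_length_eq)
  have "F0 \<in> A" using F0 by (simp add: A_def B_def)
  then have ne: "A \<noteq> {}" by blast
  define F where "F = arg_min_on (makespan \<alpha>) A"
  have F: "F \<in> A" and Fle: "\<And>F'. F' \<in> A \<Longrightarrow> makespan \<alpha> F \<le> makespan \<alpha> F'"
    using arg_min_if_finite(1)[OF fin ne] arg_min_least[OF fin ne] by (auto simp: F_def)
  have "optimal_family \<alpha> m n W F"
    unfolding optimal_family_def is_arg_min_linorder
  proof (intro conjI allI impI)
    show "F \<in> families m n W" using F by (simp add: A_def)
    fix F' assume F': "F' \<in> families m n W"
    show "makespan \<alpha> F \<le> makespan \<alpha> F'"
    proof (cases "makespan \<alpha> F' \<le> B")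
      case True then show ?thesis using F' Fle by (simp add: A_def)
    next
      case False then show ?thesis using F by (simp add: A_def)
    qed
  qed
  then show ?thesis by blast
qed

end

text \<open>
  A selection rule determines the first-stage family from the numbers of trucks and drones, the
  drone speed and the network. The set of damaged nodes is not among its arguments.
\<close>
type_synonym 'v rule =
  "nat \<Rightarrow> nat \<Rightarrow> real \<Rightarrow> 'v pair_pre_digraph \<Rightarrow> ('v \<times> 'v \<Rightarrow> real) \<Rightarrow> 'v \<Rightarrow> 'v family"

definition selection_rule :: "'v rule \<Rightarrow> bool" where
  "selection_rule S \<longleftrightarrow>
    (\<forall>kt kd \<alpha> G c v0. 1 \<le> kt \<longrightarrow> 1 \<le> kd \<longrightarrow> 0 < \<alpha> \<longrightarrow> relief_network G c v0 \<longrightarrow>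
      relief_network.optimal_family G c v0 \<alpha> kt kd (relief_network.customers G v0)
        (S kt kd \<alpha> G c v0))"

text \<open>The infimum ranges over all networks with nodes in \<open>'v\<close> and all sets \<open>D\<close> of damaged nodes. The
  ratios are nonnegative, and there are any if \<open>'v\<close> is infinite.\<close>
definition best_case_ratio :: "'v rule \<Rightarrow> nat \<Rightarrow> nat \<Rightarrow> real \<Rightarrow> real" where
  "best_case_ratio S kt kd \<alpha> =
    Inf {relief_network.optimistic G c v0 kt kd \<alpha> (S kt kd \<alpha> G c v0) D
           / relief_network.TSP G c v0 \<alpha> kt 0 (relief_network.customers G v0) | G c v0 D.
         relief_network G c v0 \<and> D \<subseteq> relief_network.customers G v0}"

lemma ex_selection_rule: "\<exists>S :: 'v rule. selection_rule S"
proof -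
  have "\<exists>F. 1 \<le> kt \<longrightarrow> 1 \<le> kd \<longrightarrow> 0 < \<alpha> \<longrightarrow> relief_network G c v0 \<longrightarrow>
      relief_network.optimal_family G c v0 \<alpha> kt kd (relief_network.customers G v0) F"
    for kt kd \<alpha> and G :: "'v pair_pre_digraph" and c v0
    using relief_network.ex_optimal_family[of G c v0 \<alpha> kt kd "relief_network.customers G v0"]
    by (fastforce simp: relief_network.customers_def)
  then show ?thesis unfolding selection_rule_def by metis
qed

end

theory Submission
  imports Defs
begin

text \<open>
  In a star with unit edges and the depot at its centre, a tour through \<open>n\<close> customers has
  length at least \<open>2n\<close>, so the trucks alone need time \<open>2M / k\<^sup>t\<close> for \<open>M\<close> customers. With the
  drones, each truck serves \<open>t\<close> customers and each drone \<open>\<lfloor>\<alpha> t\<rfloor>\<close> customers within time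
  \<open>2t\<close>. Taking \<open>M = k\<^sup>t t + k\<^sup>d \<lfloor>\<alpha> t\<rfloor>\<close> customers, none of them damaged, and letting \<open>t\<close>
  tend to infinity gives the bound.
\<close>

section \<open>Makespans, TSP values and the ratio in arbitrary networks\<close>

context relief_network
begin

lemma awalk_cost_nonneg:
  assumes "is_tour p"
  shows "0 \<le> awalk_cost c p"
proof -
  have "set p \<subseteq> parcs G" using assms by (simp add: is_tour_def awalk_def)
  then show ?thesis by (induction p) (auto dest: len_pos)
qed

lemma awalk_cost_scale: "awalk_cost (\<lambda>e. a * c e) p = a * awalk_cost c p"
  by (induction p) (auto simp: algebra_simps)

lemma cost_le_makespan:
  assumes "p \<in> set T"
  shows "awalk_cost c p \<le> makespan \<alpha> (T, R)"
  unfolding makespan_def using assms by (intro Max_ge) auto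

lemma makespan_le:
  assumes "length T + length R \<ge> 1"
    and "\<And>p. p \<in> set T \<Longrightarrow> awalk_cost c p \<le> b"
    and "\<And>p. p \<in> set R \<Longrightarrow> 1 / \<alpha> * awalk_cost c p \<le> b"
  shows "makespan \<alpha> (T, R) \<le> b"
proof -
  \<comment> \<open>With at least one vehicle, the maximum in \<open>makespan\<close> ranges over a
    nonempty set.\<close>
  have "T \<noteq> [] \<or> R \<noteq> []" using assms(1) by auto
  then show ?thesis
    unfolding makespan_def using assms(2,3) by (intro Max.boundedI)
      (auto simp: awalk_cost_scale simp del: times_divide_eq_left)
qed

lemma makespan_nonneg:
  assumes "F \<in> families m n W" "m + n \<ge> 1" "\<alpha> > 0"
  shows "0 \<le> makespan \<alpha> F"
proof -
  obtain T R where F: "F = (T, R)" by fastforce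
  let ?A = "awalk_cost c ` set T \<union> awalk_cost (\<lambda>e. 1 / \<alpha> * c e) ` set R"
  have tours: "is_tour p" if "p \<in> set T \<union> set R" for p using assms(1) that F by (auto simp: families_def)
  have "length T + length R \<ge> 1" using assms(1,2) by (auto simp: F families_def)
  then have "?A \<noteq> {}" by auto
  then have "Max ?A \<in> ?A" by (intro Max_in) auto
  moreover have "0 \<le> x" if "x \<in> ?A" for x
    using that tours assms(3) awalk_cost_nonneg
    by (auto simp: awalk_cost_scale simp del: times_divide_eq_left)
  ultimately show ?thesis by (simp add: makespan_def F)
qed

text \<open>\<open>TSP\<close> is a \<open>LEAST\<close> over reals, which is informative only once
  a minimum is known to exist. \<open>ex_optimal_family\<close> supplies it, and the later bounds on
  \<open>TSP\<close> rest on this rule.\<close>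

lemma TSP_attained:
  assumes "\<alpha> > 0" "m + n \<ge> 1" "W \<subseteq> pverts G"
  obtains F where "F \<in> families m n W" "TSP \<alpha> m n W = makespan \<alpha> F"
    "\<And>F'. F' \<in> families m n W \<Longrightarrow> makespan \<alpha> F \<le> makespan \<alpha> F'"
  using ex_optimal_family[OF assms] TSP_eqI
  unfolding optimal_family_def is_arg_min_linorder by metis

lemma TSP_le_makespan:
  assumes "\<alpha> > 0" "m + n \<ge> 1" "W \<subseteq> pverts G" "F \<in> families m n W"
  shows "TSP \<alpha> m n W \<le> makespan \<alpha> F"
  using TSP_attained[OF assms(1-3)] assms(4) by metis

lemma TSP_nonneg:
  assumes "\<alpha> > 0" "m + n \<ge> 1" "W \<subseteq> pverts G"
  shows "0 \<le> TSP \<alpha> m n W"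
  using TSP_attained[OF assms] makespan_nonneg assms by metis

text \<open>Tours of length 0 suffice. This makes the second stage free when no node is
  damaged.\<close>

lemma TSP_empty:
  assumes "\<alpha> > 0" "m + n \<ge> 1"
  shows "TSP \<alpha> m n {} = 0"
proof (rule antisym)
  let ?F = "(replicate m [], replicate n []) :: 'a family"
  have "?F \<in> families m n {}"
    using depot_in_verts by (auto simp: families_def is_tour_def awalk_Nil_iff)
  then have "TSP \<alpha> m n {} \<le> makespan \<alpha> ?F" using assms by (intro TSP_le_makespan) auto
  also have "\<dots> \<le> 0" using assms by (intro makespan_le) auto
  finally show "TSP \<alpha> m n {} \<le> 0" .
qed (use assms in \<open>auto intro: TSP_nonneg\<close>)

lemma optimistic_nonneg:
  assumes "\<alpha> > 0" "kt \<ge> 1" "D \<subseteq> customers"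
  shows "0 \<le> optimistic kt kd \<alpha> F D"
  unfolding optimistic_def using assms
  by (intro add_nonneg_nonneg TSP_nonneg) (auto simp: customers_def)

end

text \<open>A real \<open>Inf\<close> lies below its members only if the set is bounded below; here
  0 is a lower bound. Hence any single instance bounds the ratio from above.\<close>

lemma best_case_ratio_le:
  assumes "\<alpha> > 0" "kt \<ge> 1" "relief_network G c v0" "D \<subseteq> relief_network.customers G v0"
  shows "best_case_ratio S kt kd \<alpha>
    \<le> relief_network.optimistic G c v0 kt kd \<alpha> (S kt kd \<alpha> G c v0) D
        / relief_network.TSP G c v0 \<alpha> kt 0 (relief_network.customers G v0)"
  unfolding best_case_ratio_def
proof (rule cInf_lower)
  show "bdd_below {relief_network.optimistic G c v0 kt kd \<alpha> (S kt kd \<alpha> G c v0) D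
           / relief_network.TSP G c v0 \<alpha> kt 0 (relief_network.customers G v0) | G c v0 D.
         relief_network G c v0 \<and> D \<subseteq> relief_network.customers G v0}"
  proof (rule bdd_belowI, clarify)
    fix G :: "'a pair_pre_digraph" and c v0 D
    assume net: "relief_network G c v0" and D: "D \<subseteq> relief_network.customers G v0"
    interpret relief_network G c v0 by (rule net)
    show "0 \<le> optimistic kt kd \<alpha> (S kt kd \<alpha> G c v0) D / TSP \<alpha> kt 0 customers"
      using assms D by (intro divide_nonneg_nonneg optimistic_nonneg TSP_nonneg)
        (auto simp: customers_def)
  qed
qed (use assms in blast)

section \<open>The star network\<close>

text \<open>
  The metric closure of a star with unit edges and centre \<open>d\<close>; as the graph is complete,
  \<^const>\<open>node_dist\<close> is the edge length off the diagonal.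
\<close>

definition star_closure :: "'v \<Rightarrow> 'v set \<Rightarrow> 'v pair_pre_digraph" where
  "star_closure d C =
    \<lparr>pverts = insert d C, parcs = {(i, j). i \<in> insert d C \<and> j \<in> insert d C \<and> i \<noteq> j}\<rparr>"

lemma star_closure_simps [simp]:
  "pverts (star_closure d C) = insert d C"
  "(i, j) \<in> parcs (star_closure d C) \<longleftrightarrow> i \<in> insert d C \<and> j \<in> insert d C \<and> i \<noteq> j"
  by (simp_all add: star_closure_def)

text \<open>Each end contributes its distance to the centre, so two leaves are at distance 2, as on
  the path through the centre. Written as a sum over the ends, the cost of a walk can be charged to
  its visits to leaves.\<close>

definition star_len :: "'v \<Rightarrow> 'v \<times> 'v \<Rightarrow> real" where
  "star_len d e = of_bool (fst e \<noteq> d) + of_bool (snd e \<noteq> d)"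

locale star_network =
  fixes d :: 'v and C :: "'v set"
  assumes finite_leaves: "finite C" and leaves_nonempty: "C \<noteq> {}" and centre: "d \<notin> C"
begin

lemma star_graph: "pair_graph (star_closure d C)"
proof
  have "parcs (star_closure d C) \<subseteq> insert d C \<times> insert d C" by auto
  then show "finite (parcs (star_closure d C))"
    using finite_leaves by (meson finite_SigmaI finite_insert finite_subset)
qed (use finite_leaves in \<open>auto simp: symmetric_def sym_def\<close>)

lemma star_node_dist:
  assumes "i \<in> insert d C" "j \<in> insert d C"
  shows "node_dist (star_closure d C) (star_len d) i j = (if i = j then 0 else star_len d (i, j))"
proof (cases "i = j")
  case True
  interpret pair_graph "star_closure d C" by (rule star_graph)
  \<comment> \<open>There are no loops, so \<open>node_dist\<close> falls back to the shortest-path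
    distance on the diagonal. The empty walk bounds it above, nonnegative lengths bound it
    below.\<close>
  have "\<mu> (star_len d) i i = 0"
  proof (rule antisym)
    have "awalk i [] i" using assms by (simp add: awalk_Nil_iff)
    then show "\<mu> (star_len d) i i \<le> 0"
      using min_cost_le_walk_cost[of i "[]" i "star_len d"] by (simp add: zero_ereal_def)
    have "0 \<le> awalk_cost (star_len d) p" for p
      by (induction p) (auto simp: star_len_def)
    then show "0 \<le> \<mu> (star_len d) i i" unfolding \<mu>_def by (intro INF_greatest) simp
  qed
  then show ?thesis using True by (simp add: node_dist_def)
next
  case False
  then show ?thesis using assms by (simp add: node_dist_def)
qed

end

sublocale star_network \<subseteq> relief_network "star_closure d C" "star_len d" d
proof -
  interpret pair_graph "star_closure d C" by (rule star_graph)
  show "relief_network (star_closure d C) (star_len d) d"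
  proof
    have "u \<rightarrow>\<^sup>*\<^bsub>with_proj (star_closure d C)\<^esub> v"
      if "u \<in> insert d C" "v \<in> insert d C" for u v
    proof (cases "u = v")
      case False
      then show ?thesis using that by (intro reachable_adjI) auto
    qed (use that in simp)
    then show "Digraph_Component.connected (with_proj (star_closure d C))"
      unfolding connected_def strongly_connected_def by (auto intro: reachable_mk_symmetricI)
  next
    fix i j k
    assume "i \<in> pverts (star_closure d C)" "j \<in> pverts (star_closure d C)"
      "k \<in> pverts (star_closure d C)"
    then have "i \<in> insert d C" "j \<in> insert d C" "k \<in> insert d C" by auto
    then show "node_dist (star_closure d C) (star_len d) i k
        \<le> node_dist (star_closure d C) (star_len d) i j
          + node_dist (star_closure d C) (star_len d) j k"
      \<comment> \<open>For distinct nodes, \<open>i\<close> and \<open>k\<close> contribute the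
        same to both sides, and \<open>j\<close> adds a nonnegative amount on the right.\<close>
      by (auto simp: star_node_dist star_len_def)
  qed (use leaves_nonempty centre in \<open>auto simp: star_len_def\<close>)
qed

section \<open>Truck lower bound and mixed-fleet upper bound in the star\<close>

context star_network
begin

lemma customers_star: "customers = C"
  using centre by (auto simp: customers_def)

text \<open>Each arc pays half of the cost 2 of visiting a leaf at each of its ends.\<close>

lemma card_leaves_le_cost:
  assumes "pcas u p v"
  shows "2 * real (card (set (pawalk_verts u p) - {d}))
    \<le> awalk_cost (star_len d) p + of_bool (u \<noteq> d) + of_bool (v \<noteq> d)"
  using assms
proof (induction p arbitrary: u)
  case Nil
  then show ?case by (cases "u = d") auto
next
  case (Cons e p)
  let ?V = "set (pawalk_verts (snd e) p) - {d}"
  have IH: "2 * real (card ?V)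
      \<le> awalk_cost (star_len d) p + of_bool (snd e \<noteq> d) + of_bool (v \<noteq> d)"
    using Cons by simp
  have "set (pawalk_verts u (e # p)) - {d} = (if u = d then ?V else insert u ?V)"
    using Cons.prems by auto
  then have "card (set (pawalk_verts u (e # p)) - {d}) \<le> card ?V + of_bool (u \<noteq> d)"
    by (simp add: card_insert_if)
  then have "real (card (set (pawalk_verts u (e # p)) - {d})) \<le> real (card ?V) + of_bool (u \<noteq> d)"
    by (cases "u = d") auto
  with IH show ?case using Cons.prems by (simp add: star_len_def[of d e])
qed

text \<open>By \<open>card_leaves_le_cost\<close>, a closed tour at the centre reaches at most half
  as many leaves as its length. Summing over the truck tours, which together cover \<open>C\<close>,
  gives the bound.\<close>

lemma trucks_TSP_ge:
  assumes "\<alpha> > 0" "kt \<ge> 1"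
  shows "2 * real (card C) \<le> real kt * TSP \<alpha> kt 0 C"
proof -
  have "C \<subseteq> pverts (star_closure d C)" by auto
  then obtain F where F: "F \<in> families kt 0 C" and eq: "TSP \<alpha> kt 0 C = makespan \<alpha> F"
    using assms by (auto elim: TSP_attained[of \<alpha> kt 0 C])
  obtain T where FT: "F = (T, [])" using F by (auto simp: families_def)
  let ?V = "\<lambda>p. set (pawalk_verts d p) - {d}"
  have T: "length T = kt" "\<And>p. p \<in> set T \<Longrightarrow> is_tour p" "C \<subseteq> (\<Union>p\<in>set T. ?V p)"
    using F centre by (auto simp: families_def visited_def FT)
  have le: "2 * real (card (?V p)) \<le> makespan \<alpha> F" if "p \<in> set T" for p
  proof -
    have "pcas d p d" using T(2) that by (simp add: is_tour_def awalk_def)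
    then show ?thesis
      using card_leaves_le_cost[of d p d] cost_le_makespan[OF that, of \<alpha> "[]"] by (simp add: FT)
  qed
  have "card C \<le> card (\<Union>p\<in>set T. ?V p)" using T(3) by (intro card_mono) auto
  also have "\<dots> \<le> (\<Sum>p\<in>set T. card (?V p))" by (rule card_UN_le) simp
  finally have "2 * real (card C) \<le> 2 * real (\<Sum>p\<in>set T. card (?V p))" by linarith
  also have "\<dots> = (\<Sum>p\<in>set T. 2 * real (card (?V p)))" by (simp add: sum_distrib_left)
  also have "\<dots> \<le> (\<Sum>p\<in>set T. makespan \<alpha> F)" using le by (intro sum_mono)
  also have "\<dots> = real (card (set T)) * makespan \<alpha> F" by simp
  \<comment> \<open>Equal tours coincide in \<open>set T\<close>, so it has at most
    \<open>kt\<close> elements; a nonnegative makespan allows the factor to grow to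
    \<open>kt\<close>.\<close>
  also have "\<dots> \<le> real kt * makespan \<alpha> F"
    using T(1) card_length[of T] makespan_nonneg[OF F] assms by (intro mult_right_mono) auto
  finally show ?thesis by (simp add: eq)
qed

text \<open>For distinct leaves, these round trips attain equality in
  \<open>card_leaves_le_cost\<close>.\<close>

definition star_tour :: "'v list \<Rightarrow> 'v tour" where
  "star_tour xs = concat (map (\<lambda>x. [(d, x), (x, d)]) xs)"

lemma star_tour:
  assumes "set xs \<subseteq> C"
  shows is_tour_star_tour: "is_tour (star_tour xs)"
    and set_star_tour: "set xs \<subseteq> set (pawalk_verts d (star_tour xs))"
    and cost_star_tour: "awalk_cost (star_len d) (star_tour xs) = 2 * real (length xs)"
proof -
  have "pcas d (star_tour xs) d" by (induction xs) (auto simp: star_tour_def)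
  moreover have "set (star_tour xs) \<subseteq> parcs (star_closure d C)"
    using assms centre by (auto simp: star_tour_def)
  ultimately show "is_tour (star_tour xs)"
    using depot_in_verts by (simp add: is_tour_def awalk_def)
  show "set xs \<subseteq> set (pawalk_verts d (star_tour xs))"
    by (induction xs) (auto simp: star_tour_def)
  show "awalk_cost (star_len d) (star_tour xs) = 2 * real (length xs)"
    using assms centre by (induction xs) (auto simp: star_tour_def star_len_def)
qed

text \<open>Each block becomes the star tour of one vehicle, \<open>xss\<close> for the trucks and
  \<open>yss\<close> for the drones. Within time \<open>b\<close> a drone covers length
  \<open>\<alpha> * b\<close>, hence the two different budgets.\<close>

lemma TSP_le_partition:
  assumes "\<alpha> > 0" "length xss + length yss \<ge> 1"
    and "\<Union> (set ` set xss) \<union> \<Union> (set ` set yss) = C"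
    and "\<And>xs. xs \<in> set xss \<Longrightarrow> 2 * real (length xs) \<le> b"
    and "\<And>ys. ys \<in> set yss \<Longrightarrow> 2 * real (length ys) \<le> \<alpha> * b"
  shows "TSP \<alpha> (length xss) (length yss) C \<le> b"
proof -
  let ?F = "(map star_tour xss, map star_tour yss)"
  have sub: "set zs \<subseteq> C" if "zs \<in> set xss \<union> set yss" for zs using assms(3) that by blast
  have "x \<in> visited (map star_tour zss)" if "x \<in> set zs" "zs \<in> set zss" "set zs \<subseteq> C" for x zs zss
    using set_star_tour[OF that(3)] that by (auto simp: visited_def)
  then have "C \<subseteq> visited (map star_tour xss) \<union> visited (map star_tour yss)"
    using sub unfolding assms(3)[symmetric] by blast
  then have "?F \<in> families (length xss) (length yss) C"
    using is_tour_star_tour sub by (auto simp: families_def)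
  then have "TSP \<alpha> (length xss) (length yss) C \<le> makespan \<alpha> ?F"
    using assms(1,2) by (intro TSP_le_makespan) auto
  also have "\<dots> \<le> b"
    using assms sub by (intro makespan_le) (auto simp: cost_star_tour field_simps)
  finally show ?thesis .
qed

end

section \<open>The ratio on large stars and its limit\<close>

lemma Union_consecutive_blocks: "(\<Union>i<k. {a + i * n..<a + Suc i * n}) = {a..<a + k * n :: nat}"
  by (induction k) (auto simp: lessThan_Suc)

text \<open>The mixed fleet needs time at most \<open>2 * t\<close>, while the trucks alone need at
  least \<open>2 * M / kt\<close>; the bound is the quotient. The drone load \<open>n\<close> is
  left general here and becomes a floor only in the theorem.\<close>

lemma best_case_ratio_le_block:
  fixes S :: "'v rule"
  assumes inf: "infinite (UNIV :: 'v set)" and "\<alpha> > 0" "kt \<ge> 1" "t \<ge> 1"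
    and n: "real n \<le> \<alpha> * real t"
  shows "best_case_ratio S kt kd \<alpha> \<le> real (kt * t) / real (kt * t + kd * n)"
proof -
  \<comment> \<open>The star must have its nodes in \<open>'v\<close>, so they are numbered through
    an injection: 0 is the centre, 1 to \<open>M\<close> are the leaves.\<close>
  obtain f :: "nat \<Rightarrow> 'v" where f: "inj f" using infinite_countable_subset[OF inf] by blast
  define d where "d = f 0"
  define M where "M = kt * t + kd * n"
  define C where "C = f ` {1..<1 + M}"
  have M: "M > 0" using assms by (simp add: M_def)
  interpret star_network d C
    using f M by unfold_locales (auto simp: C_def d_def inj_eq)
  have card: "card C = M" using f by (simp add: C_def card_image inj_on_subset)
  \<comment> \<open>The numbers from 1 to \<open>M\<close> are cut into consecutive blocks, first
    \<open>kt\<close> blocks of size \<open>t\<close> for the trucks, then \<open>kd\<close> blocks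
    of size \<open>n\<close> for the drones.\<close>
  define xss where "xss = map (\<lambda>i. map f [1 + i * t..<1 + Suc i * t]) [0..<kt]"
  define yss where "yss = map (\<lambda>i. map f [1 + kt * t + i * n..<1 + kt * t + Suc i * n]) [0..<kd]"
  have "\<Union> (set ` set xss) = f ` (\<Union>i<kt. {1 + i * t..<1 + Suc i * t})"
    unfolding xss_def
    by (simp only: set_map set_upt image_UN image_image atLeast0LessThan)
  moreover have "\<Union> (set ` set yss) = f ` (\<Union>i<kd. {1 + kt * t + i * n..<1 + kt * t + Suc i * n})"
    unfolding yss_def
    by (simp only: set_map set_upt image_UN image_image atLeast0LessThan)
  ultimately have "\<Union> (set ` set xss) \<union> \<Union> (set ` set yss)
      = f ` ({1..<1 + kt * t} \<union> {1 + kt * t..<1 + kt * t + kd * n})"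
    by (simp only: Union_consecutive_blocks image_Un)
  also have "\<dots> = C" by (simp add: C_def M_def ivl_disj_un add.assoc)
  finally have cover: "\<Union> (set ` set xss) \<union> \<Union> (set ` set yss) = C" .
  have "TSP \<alpha> (length xss) (length yss) C \<le> 2 * real t"
    using assms cover by (intro TSP_le_partition) (auto simp: xss_def yss_def)
  then have upper: "TSP \<alpha> kt kd C \<le> 2 * real t" by (simp add: xss_def yss_def)
  have lower: "2 * real M \<le> real kt * TSP \<alpha> kt 0 C" using trucks_TSP_ge assms card by metis
  \<comment> \<open>The chosen instance has no damaged nodes, so only the first stage
    contributes.\<close>
  have "best_case_ratio S kt kd \<alpha>
      \<le> optimistic kt kd \<alpha> (S kt kd \<alpha> (star_closure d C) (star_len d) d) {} / TSP \<alpha> kt 0 customers"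
    using assms by (intro best_case_ratio_le relief_network_axioms) auto
  also have "\<dots> = TSP \<alpha> kt kd C / TSP \<alpha> kt 0 C"
    using assms by (simp add: optimistic_def customers_star TSP_empty)
  also have "\<dots> \<le> 2 * real t / (2 * real M / real kt)"
    using upper lower M assms by (intro frac_le) (auto simp: field_simps)
  also have "\<dots> = real (kt * t) / real M" using M by simp
  finally show ?thesis by (simp add: M_def)
qed

theorem lemma9:
  fixes S :: "'v rule" and kt kd :: nat and \<alpha> :: real
  assumes "infinite (UNIV :: 'v set)"
    and "selection_rule S"
    and "\<alpha> > 0" and "kt \<ge> 1" and "kd \<ge> 1"
  shows "best_case_ratio S kt kd \<alpha> \<le> 1 / (1 + \<alpha> * (real kd / real kt))"
proof -
  let ?r = "best_case_ratio S kt kd \<alpha>"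
  \<comment> \<open>This is the block bound with \<open>n\<close> replaced by its lower estimate
    \<open>\<alpha> * t - 1\<close>, after cancelling \<open>t\<close>. The condition
    \<open>1 / real t < \<alpha>\<close> below makes that estimate positive, hence also the new
    denominator.\<close>
  let ?g = "\<lambda>t. real kt / (real kt + real kd * (\<alpha> - 1 / real t))"
  have le: "?r \<le> ?g t" if t: "t \<ge> 1" "1 / real t < \<alpha>" for t
  proof -
    define n where "n = nat \<lfloor>\<alpha> * real t\<rfloor>"
    have n: "real n \<le> \<alpha> * real t" "\<alpha> * real t - 1 \<le> real n"
      using assms(3) by (simp_all add: n_def)
    have "?r \<le> real (kt * t) / real (kt * t + kd * n)"
      using assms t n by (intro best_case_ratio_le_block)
    also have "\<dots> \<le> real (kt * t) / (real kt * real t + real kd * (\<alpha> * real t - 1))"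
    proof (rule divide_left_mono)
      show "real kt * real t + real kd * (\<alpha> * real t - 1) \<le> real (kt * t + kd * n)"
        using mult_left_mono[OF n(2), of "real kd"] by simp
      have "\<alpha> * real t - 1 > 0" using t by (simp add: field_simps)
      then have "real kt * real t + real kd * (\<alpha> * real t - 1) > 0"
        using assms t by (simp add: add_pos_pos)
      then show "0 < real (kt * t + kd * n) * (real kt * real t + real kd * (\<alpha> * real t - 1))"
        using assms t by (simp add: add_pos_nonneg)
    qed simp
    also have "\<dots> = ?g t" using t by (simp add: field_simps)
    finally show ?thesis .
  qed
  have "\<forall>\<^sub>F t in sequentially. 1 / real t < \<alpha>"
    using order_tendstoD(2)[OF lim_1_over_n assms(3)] .
  then have ev: "\<forall>\<^sub>F t in sequentially. ?r \<le> ?g t"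
    using eventually_ge_at_top[of 1] by eventually_elim (rule le)
  \<comment> \<open>The limit of the denominator is nonzero, so \<open>?g\<close> converges as
    \<open>1 / real t\<close> tends to 0. The constant \<open>?r\<close> is eventually below
    \<open>?g\<close> and thus below its limit.\<close>
  have "real kt + real kd * (\<alpha> - 0) > 0" using assms by (simp add: add_pos_nonneg)
  then have "?g \<longlonglongrightarrow> real kt / (real kt + real kd * (\<alpha> - 0))"
    by (intro tendsto_intros lim_1_over_n) auto
  then have "?r \<le> real kt / (real kt + real kd * (\<alpha> - 0))"
    using ev by (rule tendsto_lowerbound) simp
  also have "\<dots> = 1 / (1 + \<alpha> * (real kd / real kt))"
    using assms by (simp add: field_simps)
  finally show ?thesis .
qed

end
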